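(* Let $X=aF_1+bF_2+cF_3$ with $a,b,c\in\mathbb R$, let $V$ be any Killing vector field of $Sol_3$ and let $\mathcal M\subset Sol_3$ be an $X$-invariant surface. If $c\neq0$, the following are equivalent: 1) $\mathcal M$ is a translator in the direction of $V$; 2) $\mathcal M$ is minimal and $V$ is tangent to $\mathcal M$.
   Context: $Sol_3$ is $\mathbb R^3$ with coordinates $(x,y,z)$, group law $(x_1,y_1,z_1)\star(x_2,y_2,z_2)=(x_1+e^{-z_1}x_2,\;y_1+e^{z_1}y_2,\;z_1+z_2)$ and left-invariant metric $\bar g=e^{2z}dx^2+e^{-2z}dy^2+dz^2$. Its Killing vector fields are the constant-coefficient linear combinations of $F_1=\partial_x$, $F_2=\partial_y$, $F_3=-x\partial_x+y\partial_y+\partial_z$. A surface $\mathcal M$ with unit normal $\nu$ is a translator in the direction of a Killing field $V$ if $H=\bar g(\nu,V)$, where $H$ is the mean curvature, i.e. the trace of the second fundamental form $A(S,T)=\bar g(\bar\nabla_S T,\nu)$ (sum of the principal curvatures). A surface is $X$-invariant if it is invariant under the one-parameter group of isometries of $Sol_3$ generated by the Killing field $X$. For $c\neq0$ this group consists of the left translations by $\left(\frac ac(1-e^{-ct}),\frac bc(e^{ct}-1),ct\right)$, $t\in\mathbb R$. *)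

theory Defs
  imports "HOL-Analysis.Analysis"
begin

text \<open>On an open subset of a Euclidean space, being of class \<open>C\<^sup>k\<^sup>+\<^sup>1\<close> means being differentiable with
  all directional derivatives of class \<open>C\<^sup>k\<close>.\<close>

primrec Ck_on :: "nat \<Rightarrow> ('a::euclidean_space \<Rightarrow> 'b::real_normed_vector) \<Rightarrow> 'a set \<Rightarrow> bool" where
  "Ck_on 0 f U \<longleftrightarrow> continuous_on U f"
| "Ck_on (Suc k) f U \<longleftrightarrow> (\<forall>x\<in>U. f differentiable (at x)) \<and>
     (\<forall>v. Ck_on k (\<lambda>x. frechet_derivative f (at x) v) U)"

definition smooth_on :: "('a::euclidean_space \<Rightarrow> 'b::real_normed_vector) \<Rightarrow> 'a set \<Rightarrow> bool" where
  "smooth_on f U \<longleftrightarrow> (\<forall>k. Ck_on k f U)"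

definition pd :: "'n::finite \<Rightarrow> (real^'n \<Rightarrow> 'b::real_normed_vector) \<Rightarrow> real^'n \<Rightarrow> 'b" where
  "pd i f x = frechet_derivative f (at x) (axis i 1)"

text \<open>\<open>g p u v\<close> is the inner product of the tangent vectors \<open>u\<close> and \<open>v\<close> at \<open>p\<close>.\<close>

type_synonym 'n metric_field = "real^'n \<Rightarrow> real^'n \<Rightarrow> real^'n \<Rightarrow> real"

definition metric_matrix :: "'n::finite metric_field \<Rightarrow> real^'n \<Rightarrow> real^'n^'n" where
  "metric_matrix g p = (\<chi> i j. g p (axis i 1) (axis j 1))"

definition christoffel :: "'n::finite metric_field \<Rightarrow> real^'n \<Rightarrow> 'n \<Rightarrow> 'n \<Rightarrow> 'n \<Rightarrow> real" where
  "christoffel g p k i j = (1/2) * (\<Sum>l\<in>UNIV. matrix_inv (metric_matrix g p) $ k $ l *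
     (pd i (\<lambda>q. metric_matrix g q $ j $ l) p + pd j (\<lambda>q. metric_matrix g q $ i $ l) p
      - pd l (\<lambda>q. metric_matrix g q $ i $ j) p))"

text \<open>The Levi-Civita covariant derivative, in the \<open>i\<close>-th coordinate direction of the parameter
  domain, of a vector field \<open>W\<close> along the map \<open>\<phi>\<close>.\<close>

definition cov_deriv ::
  "'n::finite metric_field \<Rightarrow> (real^'m::finite \<Rightarrow> real^'n) \<Rightarrow> 'm \<Rightarrow> (real^'m \<Rightarrow> real^'n) \<Rightarrow> real^'m \<Rightarrow> real^'n" where
  "cov_deriv g \<phi> i W u = pd i W u +
     (\<chi> k. \<Sum>l\<in>UNIV. \<Sum>m\<in>UNIV. christoffel g (\<phi> u) k l m * pd i \<phi> u $ l * W u $ m)"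

text \<open>The condition is \<open>L\<^sub>V g = 0\<close>. The Lie derivative is evaluated on constant fields \<open>u\<close>, \<open>w\<close>,
  for which \<open>[V, u] = - DV(u)\<close>.\<close>

definition killing_field :: "'n::finite metric_field \<Rightarrow> (real^'n \<Rightarrow> real^'n) \<Rightarrow> bool" where
  "killing_field g V \<longleftrightarrow> smooth_on V UNIV \<and>
     (\<forall>p u w. frechet_derivative (\<lambda>q. g q u w) (at p) (V p)
        + g p (frechet_derivative V (at p) u) w
        + g p u (frechet_derivative V (at p) w) = 0)"

definition flow_of :: "('a::real_normed_vector \<Rightarrow> 'a) \<Rightarrow> (real \<Rightarrow> 'a \<Rightarrow> 'a) \<Rightarrow> bool" where
  "flow_of X \<theta> \<longleftrightarrow> (\<forall>p. \<theta> 0 p = p \<and>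
     (\<forall>t. ((\<lambda>s. \<theta> s p) has_vector_derivative X (\<theta> t p)) (at t)))"

text \<open>A surface is a topological surface \<open>M\<close> with a map \<open>f\<close> into \<open>\<real>\<^sup>3\<close> that is a smooth immersion.
  The smooth structure of \<open>M\<close> is the only one for which \<open>f\<close> is an immersion, so it is not recorded
  separately: its local parametrizations are the homeomorphisms \<open>\<kappa>\<close> from open subsets of the plane onto
  open subsets of \<open>M\<close> for which \<open>f \<circ> \<kappa>\<close> is a smooth immersion. An embedded surface \<open>S \<subseteq> \<real>\<^sup>3\<close> is the
  case \<open>M = top_of_set S\<close>, \<open>f = id\<close>.\<close>

definition local_param ::
  "'a topology \<Rightarrow> ('a \<Rightarrow> real^3) \<Rightarrow> (real^2) set \<Rightarrow> (real^2 \<Rightarrow> 'a) \<Rightarrow> bool" where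
  "local_param M f U \<kappa> \<longleftrightarrow> open U \<and> openin M (\<kappa> ` U) \<and> embedding_map (top_of_set U) M \<kappa> \<and>
     smooth_on (f \<circ> \<kappa>) U \<and> (\<forall>u\<in>U. inj (frechet_derivative (f \<circ> \<kappa>) (at u)))"

definition immersed_surface :: "'a topology \<Rightarrow> ('a \<Rightarrow> real^3) \<Rightarrow> bool" where
  "immersed_surface M f \<longleftrightarrow> Hausdorff_space M \<and> second_countable M \<and>
     (\<forall>q\<in>topspace M. \<exists>U \<kappa>. local_param M f U \<kappa> \<and> q \<in> \<kappa> ` U)"

text \<open>For embedded surfaces the homeomorphism \<open>\<eta>\<close> is the restriction of \<open>\<theta> t\<close>, and the condition says
  that \<open>\<theta> t\<close> maps the surface onto itself. In general \<open>\<eta>\<close> is automatically a diffeomorphism.\<close>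

definition invariant_surface ::
  "(real^3 \<Rightarrow> real^3) \<Rightarrow> 'a topology \<Rightarrow> ('a \<Rightarrow> real^3) \<Rightarrow> bool" where
  "invariant_surface X M f \<longleftrightarrow> (\<exists>\<theta>. flow_of X \<theta> \<and>
     (\<forall>t. \<exists>\<eta>. homeomorphic_map M M \<eta> \<and> (\<forall>q\<in>topspace M. f (\<eta> q) = \<theta> t (f q))))"

definition unit_normal ::
  "3 metric_field \<Rightarrow> (real^2 \<Rightarrow> real^3) \<Rightarrow> real^2 \<Rightarrow> real^3 \<Rightarrow> bool" where
  "unit_normal g \<phi> u \<nu> \<longleftrightarrow> g (\<phi> u) \<nu> \<nu> = 1 \<and>
     (\<forall>w. g (\<phi> u) (frechet_derivative \<phi> (at u) w) \<nu> = 0)"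

definition first_ff :: "3 metric_field \<Rightarrow> (real^2 \<Rightarrow> real^3) \<Rightarrow> real^2 \<Rightarrow> real^2^2" where
  "first_ff g \<phi> u = (\<chi> i j. g (\<phi> u) (pd i \<phi> u) (pd j \<phi> u))"

text \<open>\<open>A(S,T) = g(\<nabla>\<^sub>S T, \<nu>)\<close> on the coordinate fields of the parametrization.\<close>

definition second_ff ::
  "3 metric_field \<Rightarrow> (real^2 \<Rightarrow> real^3) \<Rightarrow> real^2 \<Rightarrow> real^3 \<Rightarrow> real^2^2" where
  "second_ff g \<phi> u \<nu> = (\<chi> i j. g (\<phi> u) (cov_deriv g \<phi> i (pd j \<phi>) u) \<nu>)"

definition mean_curvature ::
  "3 metric_field \<Rightarrow> (real^2 \<Rightarrow> real^3) \<Rightarrow> real^2 \<Rightarrow> real^3 \<Rightarrow> real" where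
  "mean_curvature g \<phi> u \<nu> = trace (matrix_inv (first_ff g \<phi> u) ** second_ff g \<phi> u \<nu>)"

text \<open>Both sides of the translator equation are odd in the unit normal. It is therefore imposed for
  both unit normals at each point, and no orientability is needed.\<close>

definition translator ::
  "3 metric_field \<Rightarrow> (real^3 \<Rightarrow> real^3) \<Rightarrow> 'a topology \<Rightarrow> ('a \<Rightarrow> real^3) \<Rightarrow> bool" where
  "translator g V M f \<longleftrightarrow> (\<forall>U \<kappa> u \<nu>. local_param M f U \<kappa> \<and> u \<in> U \<and> unit_normal g (f \<circ> \<kappa>) u \<nu> \<longrightarrow>
     mean_curvature g (f \<circ> \<kappa>) u \<nu> = g (f (\<kappa> u)) \<nu> (V (f (\<kappa> u))))"

definition minimal_surface :: "3 metric_field \<Rightarrow> 'a topology \<Rightarrow> ('a \<Rightarrow> real^3) \<Rightarrow> bool" where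
  "minimal_surface g M f \<longleftrightarrow> (\<forall>U \<kappa> u \<nu>. local_param M f U \<kappa> \<and> u \<in> U \<and> unit_normal g (f \<circ> \<kappa>) u \<nu> \<longrightarrow>
     mean_curvature g (f \<circ> \<kappa>) u \<nu> = 0)"

definition tangent_to ::
  "(real^3 \<Rightarrow> real^3) \<Rightarrow> 'a topology \<Rightarrow> ('a \<Rightarrow> real^3) \<Rightarrow> bool" where
  "tangent_to V M f \<longleftrightarrow> (\<forall>U \<kappa> u. local_param M f U \<kappa> \<and> u \<in> U \<longrightarrow>
     V (f (\<kappa> u)) \<in> range (frechet_derivative (f \<circ> \<kappa>) (at u)))"

definition sol_mult :: "real^3 \<Rightarrow> real^3 \<Rightarrow> real^3" where
  "sol_mult p q = vector [p$1 + exp (- p$3) * q$1, p$2 + exp (p$3) * q$2, p$3 + q$3]"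

definition sol_metric :: "3 metric_field" where
  "sol_metric p u v = exp (2 * p$3) * u$1 * v$1 + exp (- 2 * p$3) * u$2 * v$2 + u$3 * v$3"

definition F1 :: "real^3 \<Rightarrow> real^3" where "F1 p = vector [1, 0, 0]"
definition F2 :: "real^3 \<Rightarrow> real^3" where "F2 p = vector [0, 1, 0]"
definition F3 :: "real^3 \<Rightarrow> real^3" where "F3 p = vector [- p$1, p$2, 1]"

lemma vector3_eqI: "(x::real^3) $ 1 = y $ 1 \<Longrightarrow> x $ 2 = y $ 2 \<Longrightarrow> x $ 3 = y $ 3 \<Longrightarrow> x = y"
  by (simp add: vec_eq_iff forall_3)

lemma has_vector_derivative_3:
  fixes f :: "real \<Rightarrow> real^3"
  shows "(f has_vector_derivative v) (at t) \<longleftrightarrow>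
    ((\<lambda>s. f s $ 1) has_real_derivative v $ 1) (at t) \<and>
    ((\<lambda>s. f s $ 2) has_real_derivative v $ 2) (at t) \<and>
    ((\<lambda>s. f s $ 3) has_real_derivative v $ 3) (at t)"
proof -
  have "(f has_vector_derivative v) (at t) \<longleftrightarrow>
    (\<forall>i. ((\<lambda>s. f s $ i) has_vector_derivative v $ i) (at t))"
    unfolding has_vector_derivative_def
    by (subst has_derivative_componentwise_within) (auto simp: Basis_vec_def inner_axis)
  then show ?thesis
    by (simp add: forall_3 has_real_derivative_iff_has_vector_derivative)
qed

text \<open>The flow of such a field is unique, since the field is affine.\<close>

lemma flow_of_sol_killing:
  fixes a b c :: real
  assumes "c \<noteq> 0"
  shows "flow_of (\<lambda>p. a *\<^sub>R F1 p + b *\<^sub>R F2 p + c *\<^sub>R F3 p)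
    (\<lambda>t. sol_mult (vector [a / c * (1 - exp (- c * t)), b / c * (exp (c * t) - 1), c * t]))"
  unfolding flow_of_def has_vector_derivative_3
  using assms
  by (auto intro!: vector3_eqI derivative_eq_intros
      simp: sol_mult_def F1_def F2_def F3_def field_simps)

end

theory Submission
  imports Defs
begin

text \<open>Since the dimension of the space of Killing fields is three and \<open>c \<noteq> 0\<close>, every Killing field can be
  written as \<open>V = \<alpha> F\<^sub>1 + \<beta> F\<^sub>2 + \<gamma> X\<close>. The field \<open>X\<close> is tangent to the surface, so it does not
  contribute to \<open>g(\<nu>, V)\<close>. The flow of \<open>X\<close> consists of left translations, whose differentials map \<open>F\<^sub>1\<close>
  to \<open>e\<^bsup>-ct\<^esup> F\<^sub>1\<close> and \<open>F\<^sub>2\<close> to \<open>e\<^bsup>ct\<^esup> F\<^sub>2\<close>, while \<open>H\<close> is constant along the orbits. The translator equation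
  along the orbit of a point therefore reads \<open>H = e\<^bsup>ct\<^esup> A + e\<^bsup>-ct\<^esup> B\<close> for all \<open>t\<close>, with
  \<open>A = \<alpha> g(\<nu>, F\<^sub>1)\<close> and \<open>B = \<beta> g(\<nu>, F\<^sub>2)\<close> at the point. This forces \<open>H = A = B = 0\<close>.\<close>

subsection \<open>Tangency of accumulating orbits\<close>

text \<open>If every time \<open>s\<close> were isolated, with witnesses \<open>\<delta> s\<close>
  and \<open>W s\<close>, then a basic open set containing \<open>e s\<close> inside
  \<open>W s\<close>, paired with a rational in \<open>(s, s + \<delta> s)\<close>, would determine
  \<open>s\<close>, and the reals would be countable.\<close>

lemma accumulation_time:
  fixes e :: "real \<Rightarrow> 'a"
  assumes "second_countable M" "\<And>t. e t \<in> topspace M"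
  obtains s where "\<And>\<delta> W. \<delta> > 0 \<Longrightarrow> openin M W \<Longrightarrow> e s \<in> W \<Longrightarrow>
    \<exists>t. t \<noteq> s \<and> \<bar>t - s\<bar> < \<delta> \<and> e t \<in> W"
proof (rule ccontr)
  assume "\<not> thesis"
  with that have "\<exists>\<delta> W. \<delta> > 0 \<and> openin M W \<and> e s \<in> W \<and>
      (\<forall>t. t \<noteq> s \<longrightarrow> \<bar>t - s\<bar> < \<delta> \<longrightarrow> e t \<notin> W)" for s
    by metis
  then obtain \<delta> W where W: "\<And>s. \<delta> s > 0" "\<And>s. openin M (W s)" "\<And>s. e s \<in> W s"
    "\<And>s t. t \<noteq> s \<Longrightarrow> \<bar>t - s\<bar> < \<delta> s \<Longrightarrow> e t \<notin> W s"
    by metis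
  obtain \<B> where \<B>: "countable \<B>"
    "\<And>U x. openin M U \<Longrightarrow> x \<in> U \<Longrightarrow> \<exists>V\<in>\<B>. x \<in> V \<and> V \<subseteq> U"
    using assms(1) unfolding second_countable_def by metis
  have "\<exists>V\<in>\<B>. e s \<in> V \<and> V \<subseteq> W s" for s
    using \<B>(2) W by blast
  then obtain V where V: "\<And>s. V s \<in> \<B>" "\<And>s. e s \<in> V s" "\<And>s. V s \<subseteq> W s"
    by metis
  have "\<exists>r\<in>\<rat>. s < r \<and> r < s + \<delta> s" for s
    using Rats_dense_in_real[of s "s + \<delta> s"] W(1) by auto
  then obtain r where r: "\<And>s. r s \<in> \<rat>" "\<And>s. s < r s" "\<And>s. r s < s + \<delta> s"
    by metis
  \<comment> \<open>Equal labels give \<open>s < t < r t = r s < s + \<delta> s\<close> and put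
    \<open>e t\<close> into \<open>V t = V s \<subseteq> W s\<close>, against the isolation of
    \<open>s\<close>.\<close>
  have less: False if "s < t" "V s = V t" "r s = r t" for s t
    using W(4)[of t s] V(2)[of t] V(3)[of s] r(2)[of t] r(3)[of s] that by auto
  have "inj (\<lambda>s. (V s, r s))"
    by (rule injI) (metis less linorder_neq_iff prod.inject)
  moreover have "countable (range (\<lambda>s. (V s, r s)))"
    by (rule countable_subset[of _ "\<B> \<times> \<rat>"]) (use V r \<B> countable_rat in auto)
  ultimately have "countable (UNIV :: real set)"
    using countable_image_inj_eq by blast
  then show False
    using uncountable_UNIV_real by blast
qed

text \<open>At the returning points \<open>\<phi> v = \<gamma> t\<close>, the difference quotient of
  \<open>\<gamma>\<close> is close to the image under \<open>D\<close> of \<open>v - u\<close>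
  divided by \<open>t - s\<close>. Injectivity of \<open>D\<close> keeps that argument bounded, so
  the error tends to 0 and \<open>w\<close> is a limit of vectors in the closed subspace
  \<open>range D\<close>.\<close>

lemma has_vector_derivative_mem_range:
  fixes \<phi> :: "'a::euclidean_space \<Rightarrow> 'b::euclidean_space"
  assumes \<phi>: "(\<phi> has_derivative D) (at u)" and inj: "inj D"
    and \<gamma>: "(\<gamma> has_vector_derivative w) (at s)"
    and base: "\<phi> u = \<gamma> s"
    and acc: "\<And>\<delta>. \<delta> > 0 \<Longrightarrow> \<exists>t v. t \<noteq> s \<and> \<bar>t - s\<bar> < \<delta> \<and> norm (v - u) < \<delta> \<and> \<phi> v = \<gamma> t"
  shows "w \<in> range D"
proof -
  have lin: "linear D"
    using \<phi> has_derivative_linear by blast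
  obtain B where B: "B > 0" "\<And>x. B * norm x \<le> norm (D x)"
    using linear_inj_bounded_below_pos[OF lin inj] by metis
  have "closed (range D)"
    by (intro closed_subspace linear_subspace_image lin subspace_UNIV)
  moreover have "w \<in> closure (range D)"
    unfolding closure_approachable
  proof (intro allI impI)
    fix e :: real
    assume "e > 0"
    \<comment> \<open>\<open>K\<close> is chosen so that the bound on \<open>norm y\<close> derived
      below turns the error \<open>h * \<bar>\<tau>\<bar> + h * norm y\<close> into at most
      \<open>h * K * \<bar>\<tau>\<bar>\<close>; the last bound in \<open>h\<close> then makes
      \<open>h * K \<le> e / 2\<close>.\<close>
    define K where "K = 2 / B * (norm w + 1) + 1"
    have K: "K > 0"
      unfolding K_def using B by (intro add_nonneg_pos mult_nonneg_nonneg) auto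
    define h where "h = Min {B / 2, 1, e / (2 * K)}"
    have h: "0 < h" "h \<le> B / 2" "h \<le> 1" "h \<le> e / (2 * K)"
      unfolding h_def using B K \<open>e > 0\<close> by auto
    obtain d1 where d1: "d1 > 0"
      "\<And>v. norm (v - u) < d1 \<Longrightarrow> norm (\<phi> v - \<phi> u - D (v - u)) \<le> h * norm (v - u)"
      using \<phi> h(1) unfolding has_derivative_at_alt by metis
    obtain d2 where d2: "d2 > 0"
      "\<And>t. norm (t - s) < d2 \<Longrightarrow> norm (\<gamma> t - \<gamma> s - (t - s) *\<^sub>R w) \<le> h * norm (t - s)"
      using \<gamma> h(1) unfolding has_vector_derivative_def has_derivative_at_alt by metis
    obtain t v where tv: "t \<noteq> s" "\<bar>t - s\<bar> < min d1 d2" "norm (v - u) < min d1 d2" "\<phi> v = \<gamma> t"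
      using acc[of "min d1 d2"] d1(1) d2(1) by auto
    define \<tau> y where "\<tau> = t - s" and "y = v - u"
    have \<tau>: "\<bar>\<tau>\<bar> > 0"
      using tv \<tau>_def by simp
    have "D y - \<tau> *\<^sub>R w = (\<gamma> t - \<gamma> s - (t - s) *\<^sub>R w) - (\<phi> v - \<phi> u - D (v - u))"
      using tv base by (simp add: \<tau>_def y_def)
    then have 1: "norm (D y - \<tau> *\<^sub>R w) \<le> h * \<bar>\<tau>\<bar> + h * norm y"
      using norm_triangle_ineq4[of "\<gamma> t - \<gamma> s - (t - s) *\<^sub>R w" "\<phi> v - \<phi> u - D (v - u)"]
        d1(2)[of v] d2(2)[of t] tv by (simp add: \<tau>_def y_def)
    \<comment> \<open>Since \<open>h \<le> B / 2\<close>, the error term \<open>h * norm y\<close>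
      can be absorbed on the left, which bounds \<open>norm y\<close> by a multiple of
      \<open>\<bar>\<tau>\<bar>\<close>.\<close>
    have "B * norm y \<le> norm (D y - \<tau> *\<^sub>R w) + \<bar>\<tau>\<bar> * norm w"
      using B(2)[of y] norm_triangle_sub[of "D y" "\<tau> *\<^sub>R w"] by simp
    moreover have "h * norm y \<le> B / 2 * norm y" "h * \<bar>\<tau>\<bar> \<le> 1 * \<bar>\<tau>\<bar>"
      using h by (intro mult_right_mono; simp)+
    ultimately have "B / 2 * norm y \<le> (norm w + 1) * \<bar>\<tau>\<bar>"
      using 1 by (simp add: algebra_simps)
    then have "norm y \<le> 2 / B * (norm w + 1) * \<bar>\<tau>\<bar>"
      using B by (simp add: field_simps)
    then have "h * norm y \<le> h * (2 / B * (norm w + 1) * \<bar>\<tau>\<bar>)"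
      using h by (intro mult_left_mono) auto
    then have 2: "norm (D y - \<tau> *\<^sub>R w) \<le> h * K * \<bar>\<tau>\<bar>"
      using 1 unfolding K_def by (simp add: algebra_simps)
    have "D (inverse \<tau> *\<^sub>R y) - w = inverse \<tau> *\<^sub>R (D y - \<tau> *\<^sub>R w)"
      using \<tau> lin by (simp add: linear_scale scaleR_diff_right)
    then have "norm (D (inverse \<tau> *\<^sub>R y) - w) \<le> h * K"
      using mult_left_mono[OF 2, of "\<bar>inverse \<tau>\<bar>"] \<tau> by (simp add: mult_ac flip: abs_mult)
    also have "\<dots> \<le> e / 2"
      using h(4) K by (simp add: field_simps)
    finally show "\<exists>y\<in>range D. dist y w < e"
      using \<open>e > 0\<close> by (intro bexI[of _ "D (inverse \<tau> *\<^sub>R y)"]) (auto simp: dist_norm)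
  qed
  ultimately show ?thesis
    by simp
qed

subsection \<open>Killing fields\<close>

lemma DERIV_zero_eq:
  fixes g :: "real \<Rightarrow> real"
  assumes "\<And>x. (g has_real_derivative 0) (at x)"
  shows "g x = g y"
  using DERIV_isconst_all assms by blast

text \<open>Along \<open>x\<close>, the increments of \<open>A\<close> in \<open>z\<close> are constant because \<open>A\<^sub>x\<close> does not depend on \<open>z\<close>.\<close>

lemma killing_system_plane:
  fixes A C Cx :: "real \<Rightarrow> real \<Rightarrow> real"
  assumes "k \<noteq> 0"
    and Ax: "\<And>x z. ((\<lambda>x. A x z) has_real_derivative \<sigma> * C x z) (at x)"
    and Az: "\<And>x z. ((\<lambda>z. A x z) has_real_derivative - exp (k * z) * Cx x z) (at z)"
    and Cx: "\<And>x z. ((\<lambda>x. C x z) has_real_derivative Cx x z) (at x)"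
    and Cz: "\<And>x z. ((\<lambda>z. C x z) has_real_derivative 0) (at z)"
  shows "C x z = C 0 0 + Cx 0 0 * x"
    and "A x z = A 0 0 + \<sigma> * (C 0 0 * x + Cx 0 0 * x\<^sup>2 / 2) - (exp (k * z) - 1) / k * Cx 0 0"
proof -
  have C: "C x z = C x 0" for x z
    by (rule DERIV_zero_eq[of "\<lambda>z. C x z", OF Cz])
  have Cx0: "Cx x z = Cx x 0" for x z
    by (rule DERIV_unique[OF Cx[of z x]]) (simp add: C[of _ z] Cx)
  \<comment> \<open>Integration in \<open>z\<close>: \<open>(exp (k * z) - 1) / k\<close> is the
    antiderivative of \<open>exp (k * z)\<close> vanishing at 0, and \<open>Cx\<close> does not
    depend on \<open>z\<close>.\<close>
  have Az0: "A x z = A x 0 - (exp (k * z) - 1) / k * Cx x 0" for x z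
  proof -
    have "((\<lambda>z. A x z + (exp (k * z) - 1) / k * Cx x 0) has_real_derivative 0) (at z)" for z
      by (rule DERIV_cong, (rule Az assms(1) derivative_eq_intros refl)+; simp add: \<open>k \<noteq> 0\<close> Cx0[of x z])
    then show ?thesis
      using DERIV_zero_eq[of "\<lambda>z. A x z + (exp (k * z) - 1) / k * Cx x 0" z 0] by simp
  qed
  have Cxx: "Cx x 0 = Cx 0 0" for x
  proof -
    have "((\<lambda>x. A x 1 - A x 0) has_real_derivative 0) (at x)" for x
      by (rule DERIV_cong, (rule Ax derivative_eq_intros refl)+; simp add: C[of x 1])
    then have "A x 1 - A x 0 = A 0 1 - A 0 0"
      using DERIV_zero_eq[of "\<lambda>x. A x 1 - A x 0" x 0] by simp
    \<comment> \<open>The increment from \<open>z = 0\<close> to \<open>z = 1\<close> is a nonzero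
      multiple of \<open>Cx x 0\<close>, so its constancy in \<open>x\<close> passes to
      \<open>Cx x 0\<close>.\<close>
    then have "(exp (k * 1) - 1) / k * Cx x 0 = (exp (k * 1) - 1) / k * Cx 0 0"
      using Az0[of x 1] Az0[of 0 1] by linarith
    moreover have "(exp (k * 1) - 1) / k \<noteq> 0"
      using \<open>k \<noteq> 0\<close> by simp
    ultimately show ?thesis
      using mult_left_cancel by blast
  qed
  have Cl: "C x 0 = C 0 0 + Cx 0 0 * x" for x
  proof -
    have "((\<lambda>x. C x 0 - Cx 0 0 * x) has_real_derivative 0) (at x)" for x
      by (rule DERIV_cong, (rule Cx derivative_eq_intros refl)+; simp add: Cxx[of x])
    then show ?thesis
      using DERIV_zero_eq[of "\<lambda>x. C x 0 - Cx 0 0 * x" x 0] by simp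
  qed
  show "C x z = C 0 0 + Cx 0 0 * x"
    using C[of x z] Cl[of x] by simp
  have "((\<lambda>x. A x 0 - \<sigma> * (C 0 0 * x + Cx 0 0 * x\<^sup>2 / 2)) has_real_derivative 0) (at x)" for x
    by (rule DERIV_cong, (rule Ax derivative_eq_intros refl)+; simp add: Cl[of x]; simp add: mult.commute)
  then have "A x 0 = A 0 0 + \<sigma> * (C 0 0 * x + Cx 0 0 * x\<^sup>2 / 2)"
    using DERIV_zero_eq[of "\<lambda>x. A x 0 - \<sigma> * (C 0 0 * x + Cx 0 0 * x\<^sup>2 / 2)" x 0] by simp
  then show "A x z = A 0 0 + \<sigma> * (C 0 0 * x + Cx 0 0 * x\<^sup>2 / 2) - (exp (k * z) - 1) / k * Cx 0 0"
    using Az0[of x z] Cxx[of x] by simp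
qed

text \<open>These are the Killing equations of Sol for the components \<open>A\<close>,
  \<open>B\<close>, \<open>C\<close>. Solving them in the planes of fixed \<open>y\<close> and of
  fixed \<open>x\<close> leaves \<open>C\<close> of the form
  \<open>k0 + k1 * x + k2 * y + k3 * x * y\<close>. The mixed equation \<open>AB\<close>, compared
  at different heights \<open>z\<close>, then removes \<open>k1\<close>, \<open>k2\<close> and
  \<open>k3\<close>.\<close>

lemma killing_system:
  fixes A B C Ay Bx Cx Cy :: "real \<Rightarrow> real \<Rightarrow> real \<Rightarrow> real"
  assumes Ax: "\<And>x y z. ((\<lambda>x. A x y z) has_real_derivative - C x y z) (at x)"
    and Ay: "\<And>x y z. ((\<lambda>y. A x y z) has_real_derivative Ay x y z) (at y)"
    and Az: "\<And>x y z. ((\<lambda>z. A x y z) has_real_derivative - exp (- 2 * z) * Cx x y z) (at z)"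
    and Bx: "\<And>x y z. ((\<lambda>x. B x y z) has_real_derivative Bx x y z) (at x)"
    and By: "\<And>x y z. ((\<lambda>y. B x y z) has_real_derivative C x y z) (at y)"
    and Bz: "\<And>x y z. ((\<lambda>z. B x y z) has_real_derivative - exp (2 * z) * Cy x y z) (at z)"
    and Cx: "\<And>x y z. ((\<lambda>x. C x y z) has_real_derivative Cx x y z) (at x)"
    and Cy: "\<And>x y z. ((\<lambda>y. C x y z) has_real_derivative Cy x y z) (at y)"
    and Cz: "\<And>x y z. ((\<lambda>z. C x y z) has_real_derivative 0) (at z)"
    and AB: "\<And>x y z. exp (- 2 * z) * Bx x y z + exp (2 * z) * Ay x y z = 0"
  shows "\<exists>\<alpha> \<beta> \<gamma>. \<forall>x y z. A x y z = \<alpha> - \<gamma> * x \<and> B x y z = \<beta> + \<gamma> * y \<and> C x y z = \<gamma>"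
proof -
  define k0 k1 k2 k3 where "k0 = C 0 0 0" and "k1 = Cx 0 0 0" and "k2 = Cy 0 0 0"
    and "k3 = Cy 1 0 0 - Cy 0 0 0"
  have CA: "C x y z = C 0 y 0 + Cx 0 y 0 * x"
    "A x y z = A 0 y 0 - (C 0 y 0 * x + Cx 0 y 0 * x\<^sup>2 / 2)
      + (exp (- 2 * z) - 1) / 2 * Cx 0 y 0" for x y z
    using killing_system_plane[of "-2" "\<lambda>x z. A x y z" "-1" "\<lambda>x z. C x y z" "\<lambda>x z. Cx x y z" x z]
      Ax Az Cx Cz by simp_all
  have CB: "C x y z = C x 0 0 + Cy x 0 0 * y"
    "B x y z = B x 0 0 + (C x 0 0 * y + Cy x 0 0 * y\<^sup>2 / 2)
      - (exp (2 * z) - 1) / 2 * Cy x 0 0" for x y z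
    using killing_system_plane[of 2 "\<lambda>y z. B x y z" 1 "\<lambda>y z. C x y z" "\<lambda>y z. Cy x y z" y z]
      By Bz Cy Cz by simp_all
  have C1: "C x 0 0 = k0 + k1 * x" "C 0 y 0 = k0 + k2 * y" for x y
    using CA(1)[of x 0 0] CB(1)[of 0 y 0] by (auto simp: k0_def k1_def k2_def)
  \<comment> \<open>Both plane solutions express \<open>C 1 y 0\<close>; equating them shows that
    \<open>Cx 0 y 0\<close> is affine in \<open>y\<close>.\<close>
  have p: "Cx 0 y 0 = k1 + k3 * y" for y
    using CA(1)[of 1 y 0] CB(1)[of 1 y 0] C1
    by (simp add: k1_def k2_def k3_def algebra_simps)
  have q: "Cy x 0 0 = k2 + k3 * x" for x
    using CA(1)[of x 1 0] CB(1)[of x 1 0] C1 p[of 1] by (simp add: algebra_simps)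
  have A: "A x y z = A 0 y 0 - ((k0 + k2 * y) * x + (k1 + k3 * y) * x\<^sup>2 / 2)
      + (exp (- 2 * z) - 1) / 2 * (k1 + k3 * y)" for x y z
    using CA(2)[of x y z] unfolding p C1 .
  have B: "B x y z = B x 0 0 + ((k0 + k1 * x) * y + (k2 + k3 * x) * y\<^sup>2 / 2)
      - (exp (2 * z) - 1) / 2 * (k2 + k3 * x)" for x y z
    using CB(2)[of x y z] unfolding q C1 .
  have Ay1: "Ay x y z = Ay 0 y 0 - (k2 * x + k3 * x\<^sup>2 / 2) + (exp (- 2 * z) - 1) / 2 * k3" for x y z
    by (rule DERIV_unique[OF Ay[of x z y]], subst A)
      (rule DERIV_cong, (rule Ay derivative_eq_intros zero_neq_numeral[symmetric] refl)+; simp add: field_simps)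
  have Bx1: "Bx x y z = Bx x 0 0 + (k1 * y + k3 * y\<^sup>2 / 2) - (exp (2 * z) - 1) / 2 * k3" for x y z
    by (rule DERIV_unique[OF Bx[of y z x]], subst B)
      (rule DERIV_cong, (rule Bx derivative_eq_intros zero_neq_numeral[symmetric] refl)+; simp add: field_simps)
  \<comment> \<open>After substitution of \<open>Bx1\<close> and \<open>Ay1\<close> into
    \<open>AB\<close>, the products of the two exponentials cancel; \<open>P\<close> and
    \<open>Q\<close> are the remaining coefficients of \<open>exp (- 2 * z)\<close> and
    \<open>exp (2 * z)\<close>.\<close>
  define P Q where "P x y = Bx x 0 0 + k1 * y + k3 * y\<^sup>2 / 2 + k3 / 2"
    and "Q x y = Ay 0 y 0 - k2 * x - k3 * x\<^sup>2 / 2 - k3 / 2" for x y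
  have PQ: "exp (- 2 * z) * P x y + exp (2 * z) * Q x y = 0" for x y z
  proof -
    have "E * (Bx x 0 0 + (k1 * y + k3 * y\<^sup>2 / 2) - (F - 1) / 2 * k3)
        + F * (Ay 0 y 0 - (k2 * x + k3 * x\<^sup>2 / 2) + (E - 1) / 2 * k3) = E * P x y + F * Q x y" for E F
      by (simp add: P_def Q_def field_simps)
    then show ?thesis
      using AB[where x = x and y = y and z = z] unfolding Bx1[of x y z] Ay1[of x y z] by simp
  qed
  have Q0: "Q x y = 0" for x y
  proof -
    have "P x y = - Q x y"
      using PQ[of 0 x y] by simp
    then have "(exp 2 - exp (- 2)) * Q x y = 0"
      using PQ[of 1 x y] by (simp add: algebra_simps)
    then show ?thesis
      by simp
  qed
  then have P0: "P x y = 0" for x y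
    using PQ[of 0 x y] by simp
  \<comment> \<open>\<open>P 0 y\<close> is a quadratic polynomial in \<open>y\<close> with
    coefficients from \<open>k1\<close> and \<open>k3\<close>, and \<open>Q x 0\<close> one in
    \<open>x\<close> with coefficients from \<open>k2\<close> and \<open>k3\<close>; three zeros of
    each suffice.\<close>
  have k: "k1 = 0" "k2 = 0" "k3 = 0"
    using P0[of 0 0] P0[of 0 1] P0[of 0 "-1"] Q0[of 0 0] Q0[of 1 0] Q0[of "-1" 0]
    by (auto simp: P_def Q_def)
  have A0: "A 0 y 0 = A 0 0 0" for y
    using DERIV_zero_eq[of "\<lambda>y. A 0 y 0" y 0] Ay[of 0 0] Q0[of 0] k
    by (simp add: Q_def)
  have B0: "B x 0 0 = B 0 0 0" for x
    using DERIV_zero_eq[of "\<lambda>x. B x 0 0" x 0] Bx[of 0 0] P0[of _ 0] k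
    by (simp add: P_def)
  have "A x y z = A 0 0 0 - k0 * x" "B x y z = B 0 0 0 + k0 * y" "C x y z = k0" for x y z
    using A[of x y z] B[of x y z] A0[of y] B0[of x] CA(1)[of x y z] p[of y] C1(2)[of y] k
    by simp_all
  then show ?thesis
    by blast
qed

subsection \<open>The metric of Sol and its left translations\<close>

lemma eq_matrix_inv:
  fixes A :: "real^'n^'n"
  assumes "A ** B = mat 1" "B ** A = mat 1"
  shows "matrix_inv A = B"
proof -
  have "A ** matrix_inv A = mat 1 \<and> matrix_inv A ** A = mat 1"
    unfolding matrix_inv_def by (rule someI[of _ B]) (use assms in auto)
  then show ?thesis
    by (metis assms(2) matrix_mul_assoc matrix_mul_lid matrix_mul_rid)
qed

lemma axis_nth: "axis i (a::'a::zero) $ j = (if i = j then a else 0)"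
  by (simp add: axis_def)

text \<open>The differential of the left translation by an element with third coordinate \<open>s\<close>.\<close>

definition dil :: "real \<Rightarrow> real^3 \<Rightarrow> real^3" where
  "dil s v = vector [exp (- s) * v$1, exp s * v$2, v$3]"

lemma dil_nth [simp]:
  "dil s v $ 1 = exp (- s) * v$1" "dil s v $ 2 = exp s * v$2" "dil s v $ 3 = v$3"
  by (simp_all add: dil_def)

lemma bounded_linear_dil: "bounded_linear (dil s)"
  by (rule bounded_linearI'; rule vector3_eqI; simp add: algebra_simps)

lemma inj_dil: "inj (dil s)"
proof (rule injI)
  fix v w :: "real^3"
  assume "dil s v = dil s w"
  then have "dil s v $ i = dil s w $ i" for i
    by simp
  from this[of 1] this[of 2] this[of 3] show "v = w"
    by (intro vector3_eqI) simp_all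
qed

text \<open>Left invariance of the metric: raising the third coordinate by \<open>s\<close>
  multiplies the two weights by \<open>exp (2 * s)\<close> and \<open>exp (- 2 * s)\<close>, and the
  squared factors of \<open>dil s\<close> cancel this.\<close>

lemma sol_metric_dil:
  assumes "q$3 = p$3 + s"
  shows "sol_metric q (dil s v) (dil s w) = sol_metric p v w"
proof -
  have "exp (2 * (p$3 + s)) * (exp (- s) * exp (- s)) = exp (2 * p$3)"
    "exp (- 2 * (p$3 + s)) * (exp s * exp s) = exp (- 2 * p$3)"
    by (simp_all add: mult_exp_exp algebra_simps)
  moreover have "sol_metric q (dil s v) (dil s w) =
      exp (2 * (p$3 + s)) * (exp (- s) * exp (- s)) * v$1 * w$1
      + exp (- 2 * (p$3 + s)) * (exp s * exp s) * v$2 * w$2 + v$3 * w$3"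
    by (simp add: sol_metric_def assms)
  ultimately show ?thesis
    by (simp only: sol_metric_def)
qed

lemma sol_metric_add: "sol_metric p v (w + w') = sol_metric p v w + sol_metric p v w'"
  and sol_metric_scale: "sol_metric p v (r *\<^sub>R w) = r * sol_metric p v w"
  by (simp_all add: sol_metric_def algebra_simps)

lemma sol_metric_commute: "sol_metric p v w = sol_metric p w v"
  by (simp add: sol_metric_def)

lemma has_derivative_sol_metric:
  "((\<lambda>q. sol_metric q v w) has_derivative
    (\<lambda>h. 2 * h$3 * (exp (2 * p$3) * v$1 * w$1 - exp (- 2 * p$3) * v$2 * w$2))) (at p)"
  unfolding sol_metric_def
  by (auto intro!: derivative_eq_intros bounded_linear.has_derivative[OF bounded_linear_vec_nth]
      simp: algebra_simps)

lemma pd_sol_metric: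
  "pd i (\<lambda>q. metric_matrix sol_metric q $ j $ l) p =
    (if i = 3 then 2 * (exp (2 * p$3) * axis j 1 $ 1 * axis l 1 $ 1
       - exp (- 2 * p$3) * axis j 1 $ 2 * axis l 1 $ 2) else 0)"
  unfolding pd_def metric_matrix_def
  by (simp add: frechet_derivative_at[OF has_derivative_sol_metric, symmetric] axis_nth)

lemma matrix_inv_sol_metric:
  "matrix_inv (metric_matrix sol_metric p) =
    (\<chi> i j. if i = j then vector [exp (- 2 * p$3), exp (2 * p$3), 1] $ i else 0)"
  by (intro eq_matrix_inv)
    (simp_all add: vec_eq_iff forall_3 matrix_matrix_mult_def sum_3 metric_matrix_def
      sol_metric_def mat_def axis_nth mult_exp_exp)

text \<open>The metric depends on the third coordinate only, so the nonzero symbols are, up to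
  symmetry, 1 for (1; 1,3), -1 for (2; 2,3), and \<open>- exp (2 * p$3)\<close>,
  \<open>exp (- 2 * p$3)\<close> for (3; 1,1), (3; 2,2), the upper index being written
  first.\<close>

lemma sum_christoffel_sol_metric:
  "(\<Sum>l\<in>UNIV. \<Sum>m\<in>UNIV. christoffel sol_metric p k l m * v$l * w$m) =
    vector [v$1 * w$3 + v$3 * w$1, - (v$2 * w$3 + v$3 * w$2),
      exp (- 2 * p$3) * v$2 * w$2 - exp (2 * p$3) * v$1 * w$1] $ k"
proof -
  define E F where "E = exp (2 * p$3)" and "F = exp (- 2 * p$3)"
  have "F * E = 1"
    unfolding E_def F_def by (simp flip: exp_add)
  then have EF: "F * (E * r) = r" "E * (F * r) = r" for r
    by (simp_all add: mult.commute[of E F] flip: mult.assoc)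
  have "\<forall>k. (\<Sum>l\<in>UNIV. \<Sum>m\<in>UNIV. christoffel sol_metric p k l m * v$l * w$m) =
      vector [v$1 * w$3 + v$3 * w$1, - (v$2 * w$3 + v$3 * w$2), F * v$2 * w$2 - E * v$1 * w$1] $ k"
    unfolding christoffel_def pd_sol_metric matrix_inv_sol_metric E_def[symmetric] F_def[symmetric]
    by (simp add: forall_3 sum_3 axis_nth EF mult.assoc)
  then show ?thesis
    by (simp add: E_def F_def)
qed

section \<open>Affine images of smooth maps\<close>

lemma has_derivative_affine_comp:
  assumes "bounded_linear L" "open U" "u \<in> U" "\<phi> differentiable (at u)"
    and "\<And>u. u \<in> U \<Longrightarrow> \<psi> u = T + L (\<phi> u)"
  shows "(\<psi> has_derivative (\<lambda>h. L (frechet_derivative \<phi> (at u) h))) (at u)"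
proof (rule has_derivative_transform_within_open)
  show "((\<lambda>u. T + L (\<phi> u)) has_derivative (\<lambda>h. L (frechet_derivative \<phi> (at u) h))) (at u)"
    using assms(4) unfolding frechet_derivative_works
    by (auto intro!: derivative_eq_intros bounded_linear.has_derivative[OF assms(1)])
qed (use assms in auto)

lemmas frechet_derivative_affine_comp =
  frechet_derivative_at[OF has_derivative_affine_comp, symmetric]

text \<open>Induction on \<open>k\<close>: a directional derivative of \<open>\<psi>\<close> is
  \<open>L\<close> applied to that of \<open>\<phi>\<close>, again an affine image but with
  translation part 0, hence the generalization over \<open>T\<close>.\<close>

lemma Ck_on_affine_comp:
  assumes "bounded_linear L" "open U" "Ck_on k \<phi> U" "\<And>u. u \<in> U \<Longrightarrow> \<psi> u = T + L (\<phi> u)"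
  shows "Ck_on k \<psi> U"
  using assms(3,4)
proof (induction k arbitrary: \<phi> \<psi> T)
  case 0
  then have "continuous_on U (\<lambda>u. T + L (\<phi> u))"
    by (auto intro!: continuous_intros bounded_linear.continuous_on[OF assms(1)])
  then show ?case
    using 0(2) by (auto intro: continuous_on_eq)
next
  case (Suc k)
  have D: "(\<psi> has_derivative (\<lambda>h. L (frechet_derivative \<phi> (at u) h))) (at u)" if "u \<in> U" for u
    by (rule has_derivative_affine_comp[OF assms(1,2) that _ Suc.prems(2)]) (use Suc.prems(1) that in simp)
  have "Ck_on k (\<lambda>u. frechet_derivative \<psi> (at u) v) U" for v
  proof (rule Suc.IH)
    show "Ck_on k (\<lambda>u. frechet_derivative \<phi> (at u) v) U"
      using Suc.prems by simp
    show "frechet_derivative \<psi> (at u) v = 0 + L (frechet_derivative \<phi> (at u) v)" if "u \<in> U" for u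
      by (simp flip: frechet_derivative_at[OF D[OF that]])
  qed
  moreover have "\<psi> differentiable (at u)" if "u \<in> U" for u
    using D[OF that] differentiable_def by blast
  ultimately show ?case
    by simp
qed

lemma smooth_onD:
  assumes "smooth_on \<phi> U" "u \<in> U"
  shows "\<phi> differentiable (at u)" "(\<lambda>x. frechet_derivative \<phi> (at x) v) differentiable (at u)"
proof -
  have "Ck_on (Suc (Suc 0)) \<phi> U"
    using assms unfolding smooth_on_def by blast
  then show "\<phi> differentiable (at u)" "(\<lambda>x. frechet_derivative \<phi> (at x) v) differentiable (at u)"
    using assms(2) by auto
qed

text \<open>A patch \<open>\<phi>\<close> and its left translate \<open>\<psi>\<close>, as
  \<open>sol_mult T p = T + dil (T$3) p\<close>. The two are related on the open set
  \<open>U\<close> only, which is enough to compare derivatives there.\<close>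

locale sol_translate =
  fixes U :: "(real^2) set" and \<phi> \<psi> :: "real^2 \<Rightarrow> real^3" and T :: "real^3" and s :: real
  assumes open_U: "open U" and smooth: "smooth_on \<phi> U"
    and eq: "\<And>u. u \<in> U \<Longrightarrow> \<psi> u = T + dil s (\<phi> u)" and T3: "T$3 = s"
begin

lemma frechet_derivative_translate:
  "u \<in> U \<Longrightarrow> frechet_derivative \<psi> (at u) v = dil s (frechet_derivative \<phi> (at u) v)"
  by (simp add: frechet_derivative_affine_comp[OF bounded_linear_dil open_U _ _ eq] smooth_onD(1)[OF smooth])

lemma pd_translate: "u \<in> U \<Longrightarrow> pd i \<psi> u = dil s (pd i \<phi> u)"
  by (simp add: pd_def frechet_derivative_translate)

lemma pd_pd_translate:
  assumes "u \<in> U"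
  shows "pd i (pd j \<psi>) u = dil s (pd i (pd j \<phi>) u)"
proof -
  have "pd j \<psi> x = 0 + dil s (pd j \<phi> x)" if "x \<in> U" for x
    using that by (simp add: pd_translate)
  moreover have "pd j \<phi> differentiable (at u)"
    unfolding pd_def[abs_def] by (rule smooth_onD(2)[OF smooth assms])
  ultimately show ?thesis
    unfolding pd_def[of i]
    by (subst frechet_derivative_affine_comp[OF bounded_linear_dil open_U assms]) auto
qed

lemma translate_3: "u \<in> U \<Longrightarrow> \<psi> u $ 3 = \<phi> u $ 3 + s"
  by (simp add: eq T3)

text \<open>Isometries preserve the Levi-Civita connection. Here this is visible in the closed form
  of the Christoffel terms: the first two components scale like \<open>dil s\<close>, and in the
  third the exponentials compensate.\<close>

lemma cov_deriv_translate:
  assumes "u \<in> U"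
  shows "cov_deriv sol_metric \<psi> i (pd j \<psi>) u = dil s (cov_deriv sol_metric \<phi> i (pd j \<phi>) u)"
proof -
  have "exp (- 2 * (\<phi> u $ 3 + s)) * (exp s * exp s) = exp (- 2 * \<phi> u $ 3)"
    "exp (2 * (\<phi> u $ 3 + s)) * (exp (- s) * exp (- s)) = exp (2 * \<phi> u $ 3)"
    by (simp_all add: mult_exp_exp algebra_simps)
  then have *: "exp (- 2 * (\<phi> u $ 3 + s)) * (exp s * v) * (exp s * w) = exp (- 2 * \<phi> u $ 3) * v * w"
    "exp (2 * (\<phi> u $ 3 + s)) * (exp (- s) * v) * (exp (- s) * w) = exp (2 * \<phi> u $ 3) * v * w" for v w
    by (metis mult.assoc mult.left_commute)+
  show ?thesis
    unfolding cov_deriv_def sum_christoffel_sol_metric pd_translate[OF assms]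
      pd_pd_translate[OF assms] translate_3[OF assms] dil_nth *
    by (intro vector3_eqI) (simp_all add: algebra_simps)
qed

lemma mean_curvature_translate:
  assumes "u \<in> U"
  shows "mean_curvature sol_metric \<psi> u (dil s \<nu>) = mean_curvature sol_metric \<phi> u \<nu>"
  unfolding mean_curvature_def first_ff_def second_ff_def cov_deriv_translate[OF assms]
    pd_translate[OF assms] sol_metric_dil[OF translate_3[OF assms]] ..

lemma unit_normal_translate:
  assumes "u \<in> U" "unit_normal sol_metric \<phi> u \<nu>"
  shows "unit_normal sol_metric \<psi> u (dil s \<nu>)"
  using assms(2) unfolding unit_normal_def frechet_derivative_translate[OF assms(1)]
    sol_metric_dil[OF translate_3[OF assms(1)]] .

lemma smooth_translate: "smooth_on \<psi> U"
  using Ck_on_affine_comp[where \<phi> = \<phi> and \<psi> = \<psi>, OF bounded_linear_dil open_U _ eq] smooth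
  unfolding smooth_on_def by blast

end

section \<open>Killing fields of Sol, their flows, and unit normals\<close>

lemma F_nth [simp]:
  "F1 p $ 1 = 1" "F1 p $ 2 = 0" "F1 p $ 3 = 0"
  "F2 p $ 1 = 0" "F2 p $ 2 = 1" "F2 p $ 3 = 0"
  "F3 p $ 1 = - p$1" "F3 p $ 2 = p$2" "F3 p $ 3 = 1"
  by (simp_all add: F1_def F2_def F3_def)

text \<open>The Killing equation on the six pairs of coordinate vectors is the system solved in
  \<open>killing_system\<close>, with the entries of the Jacobian \<open>D p\<close> as partial
  derivatives.\<close>

lemma killing_field_sol_metric:
  assumes "killing_field sol_metric V"
  shows "\<exists>\<alpha> \<beta> \<gamma>. \<forall>p. V p = \<alpha> *\<^sub>R F1 p + \<beta> *\<^sub>R F2 p + \<gamma> *\<^sub>R F3 p"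
proof -
  define D where "D p = frechet_derivative V (at p)" for p
  have "smooth_on V UNIV"
    using assms by (simp add: killing_field_def)
  then have D: "(V has_derivative D p) (at p)" for p
    unfolding D_def frechet_derivative_works[symmetric] using smooth_onD(1) by blast
  have K: "2 * V p $ 3 * (exp (2 * p$3) * v$1 * w$1 - exp (- 2 * p$3) * v$2 * w$2)
      + sol_metric p (D p v) w + sol_metric p v (D p w) = 0" for p v w
    using assms unfolding killing_field_def frechet_derivative_at[OF has_derivative_sol_metric, symmetric] D_def
    by blast
  define e :: "3 \<Rightarrow> real^3" where "e i = axis i 1" for i
  define P :: "real \<Rightarrow> real \<Rightarrow> real \<Rightarrow> real^3" where "P x y z = vector [x, y, z]" for x y z
  have P3 [simp]: "P x y z $ 3 = z" for x y z
    by (simp add: P_def)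
  have comp: "((\<lambda>r. V (l r) $ 1) has_real_derivative D (l t) (e i) $ 1) (at t)"
    "((\<lambda>r. V (l r) $ 2) has_real_derivative D (l t) (e i) $ 2) (at t)"
    "((\<lambda>r. V (l r) $ 3) has_real_derivative D (l t) (e i) $ 3) (at t)" if "(l has_vector_derivative e i) (at t)" for l t i
    using vector_derivative_diff_chain_within[OF that, of V "D (l t)"] D[of "l t"]
    by (auto simp: has_vector_derivative_3 o_def intro: has_derivative_at_withinI)
  have L: "((\<lambda>x. P x y z) has_vector_derivative e 1) (at x)"
    "((\<lambda>y. P x y z) has_vector_derivative e 2) (at y)"
    "((\<lambda>z. P x y z) has_vector_derivative e 3) (at z)" for x y z
    by (auto simp: has_vector_derivative_3 P_def e_def axis_nth)
  have e [simp]: "e i $ j = (if i = j then 1 else 0)" for i j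
    by (simp add: e_def axis_nth)
  have "exp (2 * p$3) * (D p (e 1) $ 1 + V p $ 3) = 0" "exp (- 2 * p$3) * (D p (e 2) $ 2 - V p $ 3) = 0" for p
    using K[of p "e 1" "e 1"] K[of p "e 2" "e 2"] by (simp_all add: sol_metric_def algebra_simps)
  then have 11: "D p (e 1) $ 1 = - V p $ 3" and 22: "D p (e 2) $ 2 = V p $ 3" for p
    by (simp_all add: eq_neg_iff_add_eq_0)
  have 33: "D p (e 3) $ 3 = 0" for p
    using K[of p "e 3" "e 3"] by (simp add: sol_metric_def)
  have "exp (- 2 * p$3) * (exp (2 * p$3) * r) = r" "exp (2 * p$3) * (exp (- 2 * p$3) * r) = r" for p :: "real^3" and r
    by (simp_all add: mult_exp_exp flip: mult.assoc)
  moreover have "exp (2 * p$3) * D p (e 3) $ 1 = - D p (e 1) $ 3"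
    "exp (- 2 * p$3) * D p (e 3) $ 2 = - D p (e 2) $ 3" for p
    using K[of p "e 1" "e 3"] K[of p "e 2" "e 3"] by (auto simp: sol_metric_def)
  ultimately have 31: "D p (e 3) $ 1 = - exp (- 2 * p$3) * D p (e 1) $ 3"
    and 32: "D p (e 3) $ 2 = - exp (2 * p$3) * D p (e 2) $ 3" for p
    by (metis mult_minus_left mult_minus_right)+
  have 12: "exp (- 2 * p$3) * D p (e 1) $ 2 + exp (2 * p$3) * D p (e 2) $ 1 = 0" for p
    using K[of p "e 1" "e 2"] by (auto simp: sol_metric_def)
  have "\<exists>\<alpha> \<beta> \<gamma>. \<forall>x y z. V (P x y z) $ 1 = \<alpha> - \<gamma> * x \<and> V (P x y z) $ 2 = \<beta> + \<gamma> * y \<and> V (P x y z) $ 3 = \<gamma>"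
  proof (rule killing_system[where Ay = "\<lambda>x y z. D (P x y z) (e 2) $ 1" and Bx = "\<lambda>x y z. D (P x y z) (e 1) $ 2"
        and Cx = "\<lambda>x y z. D (P x y z) (e 1) $ 3" and Cy = "\<lambda>x y z. D (P x y z) (e 2) $ 3"])
    fix x y z
    note 1 = comp[OF L(1)[of y z x]] and 2 = comp[OF L(2)[of x z y]] and 3 = comp[OF L(3)[of x y z]]
    show "((\<lambda>x. V (P x y z) $ 1) has_real_derivative - V (P x y z) $ 3) (at x)"
      "((\<lambda>x. V (P x y z) $ 2) has_real_derivative D (P x y z) (e 1) $ 2) (at x)"
      "((\<lambda>x. V (P x y z) $ 3) has_real_derivative D (P x y z) (e 1) $ 3) (at x)"
      using 1 unfolding 11 by auto
    show "((\<lambda>y. V (P x y z) $ 1) has_real_derivative D (P x y z) (e 2) $ 1) (at y)"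
      "((\<lambda>y. V (P x y z) $ 2) has_real_derivative V (P x y z) $ 3) (at y)"
      "((\<lambda>y. V (P x y z) $ 3) has_real_derivative D (P x y z) (e 2) $ 3) (at y)"
      using 2 unfolding 22 by auto
    show "((\<lambda>z. V (P x y z) $ 1) has_real_derivative - exp (- 2 * z) * D (P x y z) (e 1) $ 3) (at z)"
      "((\<lambda>z. V (P x y z) $ 2) has_real_derivative - exp (2 * z) * D (P x y z) (e 2) $ 3) (at z)"
      "((\<lambda>z. V (P x y z) $ 3) has_real_derivative 0) (at z)"
      using 3 unfolding 31 32 33 P3 by auto
    show "exp (- 2 * z) * D (P x y z) (e 1) $ 2 + exp (2 * z) * D (P x y z) (e 2) $ 1 = 0"
      using 12[of "P x y z"] unfolding P3 .
  qed
  then obtain \<alpha> \<beta> \<gamma> where V: "V (P x y z) $ 1 = \<alpha> - \<gamma> * x" "V (P x y z) $ 2 = \<beta> + \<gamma> * y"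
    "V (P x y z) $ 3 = \<gamma>" for x y z
    by blast
  have "V p = \<alpha> *\<^sub>R F1 p + \<beta> *\<^sub>R F2 p + \<gamma> *\<^sub>R F3 p" for p
  proof -
    have "P (p$1) (p$2) (p$3) = p"
      unfolding P_def by (intro vector3_eqI) simp_all
    then show ?thesis
      using V[of "p$1" "p$2" "p$3"] by (intro vector3_eqI) simp_all
  qed
  then show ?thesis
    by blast
qed

text \<open>Integrating factors: \<open>exp (c * t) * (\<theta> t p $ 1 - a / c)\<close>,
  \<open>exp (- c * t) * (\<theta> t p $ 2 + b / c)\<close> and
  \<open>\<theta> t p $ 3 - c * t\<close> have derivative 0 in \<open>t\<close>.\<close>

lemma flow_of_sol_killing_unique:
  fixes a b c t :: real
  assumes "c \<noteq> 0" and flow: "flow_of (\<lambda>p. a *\<^sub>R F1 p + b *\<^sub>R F2 p + c *\<^sub>R F3 p) \<theta>"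
  shows "\<theta> t p = vector [a / c * (1 - exp (- c * t)), b / c * (exp (c * t) - 1), c * t] + dil (c * t) p"
proof -
  have D: "((\<lambda>s. \<theta> s p $ 1) has_real_derivative a - c * \<theta> t p $ 1) (at t)"
    "((\<lambda>s. \<theta> s p $ 2) has_real_derivative b + c * \<theta> t p $ 2) (at t)"
    "((\<lambda>s. \<theta> s p $ 3) has_real_derivative c) (at t)" for t
    using flow by (simp_all add: flow_of_def has_vector_derivative_3)
  have 0: "\<theta> 0 p = p"
    using flow by (simp add: flow_of_def)
  define A B where "A = a / c" and "B = b / c"
  have AB: "a = c * A" "b = c * B"
    using \<open>c \<noteq> 0\<close> by (simp_all add: A_def B_def)
  have "exp (c * t) * (\<theta> t p $ 1 - A) = exp (c * 0) * (\<theta> 0 p $ 1 - A)"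
    by (rule DERIV_zero_eq[of "\<lambda>t. exp (c * t) * (\<theta> t p $ 1 - A)"])
      (auto intro!: derivative_eq_intros D(1) simp: AB algebra_simps)
  moreover have "exp (- c * t) * (\<theta> t p $ 2 + B) = exp (- c * 0) * (\<theta> 0 p $ 2 + B)"
    by (rule DERIV_zero_eq[of "\<lambda>t. exp (- c * t) * (\<theta> t p $ 2 + B)"])
      (auto intro!: derivative_eq_intros D(2) simp: AB algebra_simps)
  moreover have "\<theta> t p $ 3 - c * t = \<theta> 0 p $ 3 - c * 0"
    by (rule DERIV_zero_eq[of "\<lambda>t. \<theta> t p $ 3 - c * t"])
      (auto intro!: derivative_eq_intros D(3))
  ultimately show ?thesis
    unfolding A_def[symmetric] B_def[symmetric]
    by (intro vector3_eqI) (simp_all add: 0 exp_minus field_simps)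
qed

text \<open>Serves to detect non-tangency: the normal is built from the Euclidean component
  \<open>n\<close> of \<open>w\<close> orthogonal to \<open>S\<close>.\<close>

lemma exists_unit_normal_sol_metric:
  assumes "subspace S" "w \<notin> S"
  shows "\<exists>\<nu>. sol_metric p \<nu> \<nu> = 1 \<and> (\<forall>v\<in>S. sol_metric p v \<nu> = 0) \<and> sol_metric p \<nu> w \<noteq> 0"
proof -
  obtain y n where yn: "y \<in> span S" "\<And>v. v \<in> span S \<Longrightarrow> orthogonal n v" "w = y + n"
    using orthogonal_subspace_decomp_exists[of S w] by blast
  have S: "span S = S"
    using assms(1) by (simp add: span_eq_iff)
  have "n \<noteq> 0"
    using yn assms(2) unfolding S by auto
  \<comment> \<open>The inverse metric matrix applied to \<open>n\<close>, which converts Euclidean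
    products with \<open>n\<close> into metric products with \<open>m\<close>.\<close>
  define m :: "real^3" where "m = vector [exp (- 2 * p$3) * n$1, exp (2 * p$3) * n$2, n$3]"
  have m: "sol_metric p v m = v \<bullet> n" for v
    by (simp add: m_def sol_metric_def inner_vec_def sum_3 exp_minus field_simps)
  have "m \<noteq> 0"
    using m[of n] \<open>n \<noteq> 0\<close> by (auto simp: sol_metric_def)
  define r where "r = sol_metric p m m"
  have r: "r = exp (2 * p$3) * (m$1)\<^sup>2 + exp (- 2 * p$3) * (m$2)\<^sup>2 + (m$3)\<^sup>2"
    by (simp add: r_def sol_metric_def power2_eq_square)
  have "r \<noteq> 0"
    using \<open>m \<noteq> 0\<close> unfolding r by (auto simp: add_nonneg_eq_0_iff vec_eq_iff forall_3)
  moreover have "r \<ge> 0"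
    unfolding r by simp
  ultimately have "r > 0"
    by simp
  have 0: "v \<bullet> n = 0" if "v \<in> S" for v
    using yn(2)[of v] that by (simp add: S orthogonal_def inner_commute)
  define \<nu> where "\<nu> = (1 / sqrt r) *\<^sub>R m"
  have \<nu>: "sol_metric p v \<nu> = v \<bullet> n / sqrt r" for v
    by (simp add: \<nu>_def sol_metric_scale m)
  have "sol_metric p \<nu> \<nu> = r / (sqrt r * sqrt r)"
    unfolding \<nu> by (simp add: \<nu>_def r_def m)
  then have "sol_metric p \<nu> \<nu> = 1"
    using \<open>r > 0\<close> by simp
  moreover have "sol_metric p \<nu> w = n \<bullet> n / sqrt r"
    using yn 0[of y] by (simp add: sol_metric_commute[of p \<nu>] \<nu> S inner_add_left)
  then have "sol_metric p \<nu> w \<noteq> 0"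
    using \<open>n \<noteq> 0\<close> \<open>r > 0\<close> by simp
  moreover have "\<forall>v\<in>S. sol_metric p v \<nu> = 0"
    using \<nu> 0 by simp
  ultimately show ?thesis
    by blast
qed

subsection \<open>Invariant surfaces\<close>

lemma local_param_openin_image:
  assumes "local_param M f U \<kappa>" "openin (top_of_set U) W"
  shows "openin M (\<kappa> ` W)"
proof -
  have \<kappa>: "openin M (\<kappa> ` U)" "homeomorphic_map (top_of_set U) (subtopology M (\<kappa> ` U)) \<kappa>"
    using assms(1) by (auto simp: local_param_def embedding_map_def)
  then have "openin (subtopology M (\<kappa> ` U)) (\<kappa> ` W)"
    using assms(2) homeomorphic_imp_open_map open_map_def by blast
  then show ?thesis
    using \<kappa>(1) openin_trans_full by blast
qed

lemma unit_normal_range: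
  assumes "unit_normal sol_metric \<phi> u \<nu>" "w \<in> range (frechet_derivative \<phi> (at u))"
  shows "sol_metric (\<phi> u) \<nu> w = 0"
  using assms unfolding unit_normal_def by (subst sol_metric_commute) auto

locale sol_invariant =
  fixes a b c :: real and X :: "real^3 \<Rightarrow> real^3" and M :: "'a topology" and f :: "'a \<Rightarrow> real^3"
    and \<theta> :: "real \<Rightarrow> real^3 \<Rightarrow> real^3" and \<eta> :: "real \<Rightarrow> 'a \<Rightarrow> 'a"
  assumes c: "c \<noteq> 0"
    and X: "X = (\<lambda>p. a *\<^sub>R F1 p + b *\<^sub>R F2 p + c *\<^sub>R F3 p)"
    and M: "second_countable M"
    and flow: "flow_of X \<theta>"
    and \<eta>: "\<And>t. homeomorphic_map M M (\<eta> t)"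
    and f_\<eta>: "\<And>t q. q \<in> topspace M \<Longrightarrow> f (\<eta> t q) = \<theta> t (f q)"
begin

definition shift :: "real \<Rightarrow> real^3" where
  "shift t = vector [a / c * (1 - exp (- c * t)), b / c * (exp (c * t) - 1), c * t]"

lemma \<theta>_eq: "\<theta> t p = shift t + dil (c * t) p"
  unfolding shift_def using flow_of_sol_killing_unique[OF c] flow X by blast

lemma \<theta>_add: "\<theta> s (\<theta> t p) = \<theta> (s + t) p"
  unfolding \<theta>_eq
  by (intro vector3_eqI) (simp_all add: shift_def algebra_simps flip: exp_add)

lemma \<theta>_eqD:
  assumes "\<theta> s p = \<theta> t q"
  shows "p = \<theta> (t - s) q"
  using \<theta>_add[of "- s" s p] \<theta>_add[of "- s" t q] assms flow by (simp add: flow_of_def)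

text \<open>A flow carries its generator to itself, and \<open>dil (c * t)\<close> is the
  differential of \<open>\<theta> t\<close>.\<close>

lemma X_\<theta>: "X (\<theta> t p) = dil (c * t) (X p)"
  unfolding \<theta>_eq X using c by (intro vector3_eqI) (simp_all add: shift_def field_simps)

lemma local_param_in_topspace:
  assumes "local_param M f U \<kappa>" "u \<in> U"
  shows "\<kappa> u \<in> topspace M"
  using assms openin_subset unfolding local_param_def by blast

lemma sol_translate_comp:
  assumes "local_param M f U \<kappa>"
  shows "sol_translate U (f \<circ> \<kappa>) (f \<circ> (\<eta> t \<circ> \<kappa>)) (shift t) (c * t)"
  using assms local_param_in_topspace[OF assms]
  by unfold_locales (auto simp: local_param_def f_\<eta> \<theta>_eq shift_def)

text \<open>Moves a patch along the orbits: since \<open>f\<close> intertwines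
  \<open>\<eta> t\<close> with \<open>\<theta> t\<close>, the new patch is a left translate of the
  old one as a map into Sol.\<close>

lemma local_param_comp:
  assumes "local_param M f U \<kappa>"
  shows "local_param M f U (\<eta> t \<circ> \<kappa>)"
proof -
  interpret sol_translate U "f \<circ> \<kappa>" "f \<circ> (\<eta> t \<circ> \<kappa>)" "shift t" "c * t"
    using assms by (rule sol_translate_comp)
  have \<kappa>: "openin M (\<kappa> ` U)" "embedding_map (top_of_set U) M \<kappa>"
    "\<And>u. u \<in> U \<Longrightarrow> inj (frechet_derivative (f \<circ> \<kappa>) (at u))"
    using assms by (auto simp: local_param_def)
  have "openin M (\<eta> t ` \<kappa> ` U)"
    using homeomorphic_imp_open_map[OF \<eta>] \<kappa>(1) unfolding open_map_def by blast
  moreover have "embedding_map (top_of_set U) M (\<eta> t \<circ> \<kappa>)"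
    using embedding_map_compose[OF \<kappa>(2)] surjective_embedding_map[THEN iffD2, OF \<eta>] by blast
  moreover have "inj (frechet_derivative (f \<circ> (\<eta> t \<circ> \<kappa>)) (at u))" if "u \<in> U" for u
  proof -
    have "frechet_derivative (f \<circ> (\<eta> t \<circ> \<kappa>)) (at u) = dil (c * t) \<circ> frechet_derivative (f \<circ> \<kappa>) (at u)"
      using frechet_derivative_translate[OF that] by (simp add: fun_eq_iff)
    then show ?thesis
      using inj_compose[OF inj_dil \<kappa>(3)[OF that]] by simp
  qed
  ultimately show ?thesis
    using smooth_translate open_U unfolding local_param_def by (simp add: image_comp)
qed

text \<open>The homeomorphisms \<open>\<eta> t\<close> need not depend continuously on \<open>t\<close>. However, by second countability
  the points \<open>\<eta> t q\<close> accumulate at one of them, \<open>\<eta> s q\<close>; moving this back by \<open>\<eta> s\<close> shows that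
  the orbit of \<open>f q\<close> returns to the surface near \<open>q\<close> at arbitrarily small times.\<close>

lemma X_tangent:
  assumes \<kappa>: "local_param M f U \<kappa>" and u: "u \<in> U"
  shows "X (f (\<kappa> u)) \<in> range (frechet_derivative (f \<circ> \<kappa>) (at u))"
proof -
  have q: "\<eta> t (\<kappa> u) \<in> topspace M" for t
    using local_param_in_topspace[OF local_param_comp[OF \<kappa>] u] by simp
  obtain s where s: "\<And>\<delta> W. \<delta> > 0 \<Longrightarrow> openin M W \<Longrightarrow> \<eta> s (\<kappa> u) \<in> W \<Longrightarrow>
      \<exists>t. t \<noteq> s \<and> \<bar>t - s\<bar> < \<delta> \<and> \<eta> t (\<kappa> u) \<in> W"
    using accumulation_time[of M "\<lambda>t. \<eta> t (\<kappa> u)", OF M q] by blast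
  show ?thesis
  proof (rule has_vector_derivative_mem_range)
    show "(f \<circ> \<kappa> has_derivative frechet_derivative (f \<circ> \<kappa>) (at u)) (at u)"
      unfolding frechet_derivative_works[symmetric]
      using smooth_onD(1)[OF _ u] \<kappa> unfolding local_param_def by blast
    show "inj (frechet_derivative (f \<circ> \<kappa>) (at u))"
      using \<kappa> u by (simp add: local_param_def)
    show "((\<lambda>t. \<theta> t (f (\<kappa> u))) has_vector_derivative X (f (\<kappa> u))) (at 0)"
      "(f \<circ> \<kappa>) u = \<theta> 0 (f (\<kappa> u))"
      using flow unfolding flow_of_def by (metis, simp)
    fix \<delta> :: real
    assume "\<delta> > 0"
    \<comment> \<open>Reaching \<open>W\<close> at time \<open>t\<close> means
      \<open>\<eta> t (\<kappa> u) = \<eta> s (\<kappa> v)\<close> with \<open>v\<close> near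
      \<open>u\<close>; applying \<open>f\<close> and cancelling \<open>\<theta> s\<close> gives a
      return at the small time \<open>t - s\<close>.\<close>
    define W where "W = (\<eta> s \<circ> \<kappa>) ` (U \<inter> ball u \<delta>)"
    have "openin M W"
      unfolding W_def using local_param_openin_image[OF local_param_comp[OF \<kappa>]]
      by (simp add: openin_open_Int)
    moreover have "\<eta> s (\<kappa> u) \<in> W"
      using u \<open>\<delta> > 0\<close> by (auto simp: W_def)
    ultimately obtain t where t: "t \<noteq> s" "\<bar>t - s\<bar> < \<delta>" "\<eta> t (\<kappa> u) \<in> W"
      using s \<open>\<delta> > 0\<close> by blast
    then obtain v where v: "v \<in> U" "dist u v < \<delta>" "\<eta> t (\<kappa> u) = \<eta> s (\<kappa> v)"
      by (auto simp: W_def)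
    have "\<theta> s (f (\<kappa> v)) = \<theta> t (f (\<kappa> u))"
      using f_\<eta> local_param_in_topspace[OF \<kappa>] u v by metis
    then have "(f \<circ> \<kappa>) v = \<theta> (t - s) (f (\<kappa> u))"
      using \<theta>_eqD by simp
    then show "\<exists>t v. t \<noteq> 0 \<and> \<bar>t - 0\<bar> < \<delta> \<and> norm (v - u) < \<delta> \<and> (f \<circ> \<kappa>) v = \<theta> t (f (\<kappa> u))"
      using t v by (intro exI[of _ "t - s"] exI[of _ v]) (auto simp: dist_norm norm_minus_commute)
  qed
qed

section \<open>The translator equation along an orbit\<close>

lemma translator_imp:
  assumes V: "\<And>p. V p = \<alpha> *\<^sub>R F1 p + \<beta> *\<^sub>R F2 p + \<gamma> *\<^sub>R X p"
    and trans: "translator sol_metric V M f"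
    and \<kappa>: "local_param M f U \<kappa>" and u: "u \<in> U" and \<nu>: "unit_normal sol_metric (f \<circ> \<kappa>) u \<nu>"
  shows "mean_curvature sol_metric (f \<circ> \<kappa>) u \<nu> = 0"
proof -
  define p where "p = f (\<kappa> u)"
  define A B where "A = \<alpha> * sol_metric p \<nu> (F1 p)" and "B = \<beta> * sol_metric p \<nu> (F2 p)"
  have X0: "sol_metric p \<nu> (X p) = 0"
    using unit_normal_range[OF \<nu> X_tangent[OF \<kappa> u]] by (simp add: p_def)
  have H: "mean_curvature sol_metric (f \<circ> \<kappa>) u \<nu> = exp (c * t) * A + exp (- c * t) * B" for t
  proof -
    interpret sol_translate U "f \<circ> \<kappa>" "f \<circ> (\<eta> t \<circ> \<kappa>)" "shift t" "c * t"
      using \<kappa> by (rule sol_translate_comp)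
    have q: "f (\<eta> t (\<kappa> u)) = \<theta> t p"
      using f_\<eta> local_param_in_topspace[OF \<kappa> u] by (simp add: p_def)
    \<comment> \<open>\<open>F1\<close> and \<open>F2\<close> are constant fields, so writing their
      values as images under \<open>dil (c * t)\<close> introduces the factors
      \<open>exp (c * t)\<close> and \<open>exp (- c * t)\<close>.\<close>
    have "V (\<theta> t p) = dil (c * t) (\<alpha> *\<^sub>R exp (c * t) *\<^sub>R F1 p + \<beta> *\<^sub>R exp (- c * t) *\<^sub>R F2 p + \<gamma> *\<^sub>R X p)"
      unfolding V X_\<theta> by (intro vector3_eqI) (simp_all add: exp_minus field_simps)
    moreover have "mean_curvature sol_metric (f \<circ> \<kappa>) u \<nu>
        = sol_metric (\<theta> t p) (dil (c * t) \<nu>) (V (\<theta> t p))"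
    proof -
      have "mean_curvature sol_metric (f \<circ> (\<eta> t \<circ> \<kappa>)) u (dil (c * t) \<nu>)
          = sol_metric (f ((\<eta> t \<circ> \<kappa>) u)) (dil (c * t) \<nu>) (V (f ((\<eta> t \<circ> \<kappa>) u)))"
        using trans local_param_comp[OF \<kappa>, of t] u unit_normal_translate[OF u \<nu>]
        unfolding translator_def by blast
      then show ?thesis
        by (simp add: mean_curvature_translate[OF u] q)
    qed
    moreover have "(\<theta> t p) $ 3 = p $ 3 + c * t"
      by (simp add: \<theta>_eq shift_def)
    ultimately show ?thesis
      by (simp only: sol_metric_dil) (simp add: sol_metric_add sol_metric_scale X0 A_def B_def)
  qed
  define H where "H = mean_curvature sol_metric (f \<circ> \<kappa>) u \<nu>"
  \<comment> \<open>Substitution \<open>r = exp (c * t)\<close>. The values 1, 2, 4 of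
    \<open>r\<close> give three linear equations in \<open>H\<close>, \<open>A\<close>,
    \<open>B\<close> whose only solution is zero.\<close>
  have "H = r * A + B / r" if "r > 0" for r
    using H[of "ln r / c"] c that by (simp add: H_def exp_minus field_simps)
  from this[of 1] this[of 2] this[of 4] show ?thesis
    unfolding H_def[symmetric] by simp
qed

lemma translator_iff:
  assumes V: "killing_field sol_metric V"
  shows "translator sol_metric V M f \<longleftrightarrow> minimal_surface sol_metric M f \<and> tangent_to V M f"
proof
  assume *: "minimal_surface sol_metric M f \<and> tangent_to V M f"
  show "translator sol_metric V M f"
    unfolding translator_def
  proof (intro allI impI)
    fix U \<kappa> u \<nu>
    assume A: "local_param M f U \<kappa> \<and> u \<in> U \<and> unit_normal sol_metric (f \<circ> \<kappa>) u \<nu>"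
    then have "V (f (\<kappa> u)) \<in> range (frechet_derivative (f \<circ> \<kappa>) (at u))"
      using * unfolding tangent_to_def by blast
    then have "sol_metric (f (\<kappa> u)) \<nu> (V (f (\<kappa> u))) = 0"
      using A unit_normal_range[of "f \<circ> \<kappa>" u \<nu>] by simp
    then show "mean_curvature sol_metric (f \<circ> \<kappa>) u \<nu> = sol_metric (f (\<kappa> u)) \<nu> (V (f (\<kappa> u)))"
      using * A unfolding minimal_surface_def by metis
  qed
next
  assume trans: "translator sol_metric V M f"
  obtain \<alpha> \<beta> \<gamma> where "\<And>p. V p = \<alpha> *\<^sub>R F1 p + \<beta> *\<^sub>R F2 p + \<gamma> *\<^sub>R F3 p"
    using killing_field_sol_metric[OF V] by blast
  \<comment> \<open>\<open>F3\<close> is eliminated by means of \<open>X\<close>, dividing by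
    \<open>c\<close>.\<close>
  then have "V p = (\<alpha> - \<gamma> * a / c) *\<^sub>R F1 p + (\<beta> - \<gamma> * b / c) *\<^sub>R F2 p + (\<gamma> / c) *\<^sub>R X p" for p
    unfolding X using c by (intro vector3_eqI) (simp_all add: field_simps)
  note min = translator_imp[OF this trans]
  show "minimal_surface sol_metric M f \<and> tangent_to V M f"
    unfolding minimal_surface_def tangent_to_def
  proof (intro conjI allI impI, use min in blast)
    fix U \<kappa> u
    assume A: "local_param M f U \<kappa> \<and> u \<in> U"
    define D where "D = frechet_derivative (f \<circ> \<kappa>) (at u)"
    have "linear D"
      unfolding D_def using A smooth_onD(1) linear_frechet_derivative unfolding local_param_def by blast
    then have sub: "subspace (range D)"
      by (intro linear_subspace_image subspace_UNIV)
    \<comment> \<open>By minimality the translator equation says that every unit normal is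
      orthogonal to \<open>V\<close>; a vector outside the tangent plane would violate this for some
      unit normal.\<close>
    show "V (f (\<kappa> u)) \<in> range D"
    proof (rule ccontr)
      assume "V (f (\<kappa> u)) \<notin> range D"
      then obtain \<nu> where \<nu>: "sol_metric (f (\<kappa> u)) \<nu> \<nu> = 1" "\<forall>v\<in>range D. sol_metric (f (\<kappa> u)) v \<nu> = 0"
        "sol_metric (f (\<kappa> u)) \<nu> (V (f (\<kappa> u))) \<noteq> 0"
        using exists_unit_normal_sol_metric[OF sub] by metis
      then have "unit_normal sol_metric (f \<circ> \<kappa>) u \<nu>"
        by (simp add: unit_normal_def D_def)
      then show False
        using min trans A \<nu>(3) unfolding translator_def by metis
    qed
  qed
qed

end

theorem theorem1p3:
  fixes a b c :: real
    and X V :: "real^3 \<Rightarrow> real^3"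
    and M :: "'a topology"
    and f :: "'a \<Rightarrow> real^3"
  assumes "X = (\<lambda>p. a *\<^sub>R F1 p + b *\<^sub>R F2 p + c *\<^sub>R F3 p)"
    and "killing_field sol_metric V"
    and "immersed_surface M f"
    and "invariant_surface X M f"
    and "c \<noteq> 0"
  shows "translator sol_metric V M f \<longleftrightarrow>
    minimal_surface sol_metric M f \<and> tangent_to V M f"
proof -
  obtain \<theta> where \<theta>: "flow_of X \<theta>"
    "\<And>t. \<exists>\<eta>. homeomorphic_map M M \<eta> \<and> (\<forall>q\<in>topspace M. f (\<eta> q) = \<theta> t (f q))"
    using assms(4) unfolding invariant_surface_def by blast
  then obtain \<eta> where "\<And>t. homeomorphic_map M M (\<eta> t)"
    "\<And>t q. q \<in> topspace M \<Longrightarrow> f (\<eta> t q) = \<theta> t (f q)"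
    by metis
  then interpret sol_invariant a b c X M f \<theta> \<eta>
    using assms \<theta>(1) by unfold_locales (auto simp: immersed_surface_def)
  show ?thesis
    using assms(2) by (rule translator_iff)
qed

end
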